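(* Let $\alpha$ be a (sufficiently differentiable) regular curve, parametrized by arc-length $s$, with nowhere zero torsion in $\mathbb{S}^3(r)$ or $\mathbb{H}^3(r)$. If $\alpha$ lies on a geodesic sphere, then its curvature $\kappa$ and torsion $\tau$ satisfy $$\frac{\mathrm d}{\mathrm ds}\left[\frac1\tau\frac{\mathrm d}{\mathrm ds}\left(\frac1\kappa\right)\right]+\frac{\tau}{\kappa}=0 .$$
   Context: $\mathbb{S}^3(r)$ is the 3-dimensional sphere of radius $r$ (constant sectional curvature $1/r^2$) and $\mathbb{H}^3(r)$ the 3-dimensional hyperbolic space of constant sectional curvature $-1/r^2$, with Levi-Civita connection $\nabla$. The Frenet frame $\{\mathbf t,\mathbf n,\mathbf b\}$ along $\alpha$ is the positively oriented orthonormal frame with $\mathbf t=\alpha'$, $\kappa=\Vert\nabla_{\mathbf t}\mathbf t\Vert>0$, $\nabla_{\mathbf t}\mathbf t=\kappa\mathbf n$, $\nabla_{\mathbf t}\mathbf n=-\kappa\mathbf t+\tau\mathbf b$, $\nabla_{\mathbf t}\mathbf b=-\tau\mathbf n$. A geodesic sphere is the set of points at a fixed geodesic distance from a given point $p$. *)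

theory Defs
  imports "HOL-Analysis.Analysis"
begin

text \<open>
  The 3-sphere of radius \<open>r\<close> is the hypersurface \<open>x \<bullet> x = r\<^sup>2\<close> of Euclidean 4-space, and hyperbolic
  3-space of curvature \<open>- 1 / r\<^sup>2\<close> is the upper sheet of the hyperboloid \<open>\<langle>x, x\<rangle> = - r\<^sup>2\<close> in Minkowski
  4-space. The first coordinate is the time coordinate. In both cases the Riemannian metric is
  the restriction of the ambient form to the tangent spaces.
\<close>

datatype space_form = Sph | Hyp

fun form :: "space_form \<Rightarrow> real ^ 4 \<Rightarrow> real ^ 4 \<Rightarrow> real" where
  "form Sph x y = x $ 1 * y $ 1 + x $ 2 * y $ 2 + x $ 3 * y $ 3 + x $ 4 * y $ 4"
| "form Hyp x y = - (x $ 1 * y $ 1) + x $ 2 * y $ 2 + x $ 3 * y $ 3 + x $ 4 * y $ 4"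

fun points :: "space_form \<Rightarrow> real \<Rightarrow> (real ^ 4) set" where
  "points Sph r = {x. form Sph x x = r\<^sup>2}"
| "points Hyp r = {x. form Hyp x x = - r\<^sup>2 \<and> x $ 1 > 0}"

text \<open>The position vector is normal to both hypersurfaces, since each is a level set of \<open>form M x x\<close>.\<close>

definition tangent_space :: "space_form \<Rightarrow> real ^ 4 \<Rightarrow> (real ^ 4) set" where
  "tangent_space M x = {v. form M x v = 0}"

definition tangent_proj :: "space_form \<Rightarrow> real ^ 4 \<Rightarrow> real ^ 4 \<Rightarrow> real ^ 4" where
  "tangent_proj M x v = v - (form M x v / form M x x) *\<^sub>R x"

text \<open>
  The Levi-Civita connection of a nondegenerate submanifold of a flat (pseudo-)Euclidean space is
  the tangential part of the flat connection. Hence the covariant derivative along \<open>\<alpha>\<close> of a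
  tangent field \<open>V\<close> is the tangential part of its ordinary derivative.
\<close>

definition has_covariant_derivative ::
    "space_form \<Rightarrow> (real \<Rightarrow> real ^ 4) \<Rightarrow> (real \<Rightarrow> real ^ 4) \<Rightarrow> real ^ 4 \<Rightarrow> real \<Rightarrow> bool" where
  "has_covariant_derivative M \<alpha> V D s \<longleftrightarrow>
     (\<exists>V'. (V has_vector_derivative V') (at s) \<and> D = tangent_proj M (\<alpha> s) V')"

text \<open>
  The geodesic distance is the infimum of the lengths of piecewise continuously differentiable
  curves. The predicate \<open>valid_path\<close> does not bound the speed near the finitely many
  exceptional points, so a curve might have infinite length. The relation \<open>has_integral\<close>
  excludes such curves, which \<open>integral\<close> would give the length 0.
\<close>

definition path_lengths :: "space_form \<Rightarrow> real \<Rightarrow> real ^ 4 \<Rightarrow> real ^ 4 \<Rightarrow> real set" where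
  "path_lengths M r x y =
     {L. \<exists>g. valid_path g \<and> path_image g \<subseteq> points M r \<and> pathstart g = x \<and> pathfinish g = y \<and>
        ((\<lambda>u. sqrt (form M (vector_derivative g (at u)) (vector_derivative g (at u))))
           has_integral L) {0..1}}"

definition geodesic_dist :: "space_form \<Rightarrow> real \<Rightarrow> real ^ 4 \<Rightarrow> real ^ 4 \<Rightarrow> real" where
  "geodesic_dist M r x y = Inf (path_lengths M r x y)"

definition geodesic_sphere :: "space_form \<Rightarrow> real \<Rightarrow> real ^ 4 \<Rightarrow> real \<Rightarrow> (real ^ 4) set" where
  "geodesic_sphere M r p \<rho> = {x \<in> points M r. geodesic_dist M r p x = \<rho>}"

text \<open>Class \<open>C\<^sup>k\<close>. The case \<open>k = 1\<close> is \<open>C1_differentiable_on\<close>.\<close>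

primrec Ck_on :: "nat \<Rightarrow> (real \<Rightarrow> 'a::real_normed_vector) \<Rightarrow> real set \<Rightarrow> bool" where
  "Ck_on 0 f S \<longleftrightarrow> continuous_on S f"
| "Ck_on (Suc k) f S \<longleftrightarrow>
     (\<exists>D. (\<forall>s\<in>S. (f has_vector_derivative D s) (at s)) \<and> Ck_on k D S)"

text \<open>
  Orientation: a tangent basis at \<open>x\<close> is positive if, preceded by \<open>x\<close>, it is a positive basis of
  the ambient space. For the sphere this is the outward-normal-first convention.
  The condition \<open>form M (t s) (t s) = 1\<close> says that \<open>\<alpha>\<close> is parametrized by arc length. As \<open>n s\<close> is
  a unit vector and \<open>\<kappa> s > 0\<close>, the first Frenet equation makes \<open>\<kappa> s\<close> the norm of the covariant
  derivative of \<open>t\<close>.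
\<close>

definition frenet_frame ::
    "space_form \<Rightarrow> (real \<Rightarrow> real ^ 4) \<Rightarrow> real set \<Rightarrow> (real \<Rightarrow> real ^ 4) \<Rightarrow> (real \<Rightarrow> real ^ 4) \<Rightarrow>
     (real \<Rightarrow> real ^ 4) \<Rightarrow> (real \<Rightarrow> real) \<Rightarrow> (real \<Rightarrow> real) \<Rightarrow> bool" where
  "frenet_frame M \<alpha> I t n b \<kappa> \<tau> \<longleftrightarrow>
     (\<forall>s\<in>I.
        (\<alpha> has_vector_derivative t s) (at s) \<and>
        t s \<in> tangent_space M (\<alpha> s) \<and> n s \<in> tangent_space M (\<alpha> s) \<and> b s \<in> tangent_space M (\<alpha> s) \<and>
        form M (t s) (t s) = 1 \<and> form M (n s) (n s) = 1 \<and> form M (b s) (b s) = 1 \<and>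
        form M (t s) (n s) = 0 \<and> form M (t s) (b s) = 0 \<and> form M (n s) (b s) = 0 \<and>
        det (vector [\<alpha> s, t s, n s, b s] :: real ^ 4 ^ 4) > 0 \<and>
        \<kappa> s > 0 \<and>
        has_covariant_derivative M \<alpha> t (\<kappa> s *\<^sub>R n s) s \<and>
        has_covariant_derivative M \<alpha> n (- \<kappa> s *\<^sub>R t s + \<tau> s *\<^sub>R b s) s \<and>
        has_covariant_derivative M \<alpha> b (- \<tau> s *\<^sub>R n s) s)"

end

theory Submission
  imports Defs
begin

text \<open>
  Both spaces are level sets of a bilinear form on \<open>\<real>\<^sup>4\<close>, and the geodesic distance from \<open>p\<close> to \<open>x\<close> is
  \<open>r arccos (\<langle>p, x\<rangle> / r\<^sup>2)\<close> in the sphere and \<open>r arcosh (- \<langle>p, x\<rangle> / r\<^sup>2)\<close> in hyperbolic space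
  (\<open>geodesic_dist_eq\<close>). A geodesic sphere about \<open>p\<close> is therefore a hyperplane section: \<open>\<langle>p, x\<rangle>\<close> is
  constant on it.

  For a curve \<open>\<alpha>\<close> on such a section, differentiate \<open>\<langle>p, \<alpha>\<rangle> = c\<close> repeatedly. In the ambient space the
  Frenet equations are \<open>\<alpha>' = t\<close>, \<open>t' = \<kappa> n - (\<epsilon> / r\<^sup>2) \<alpha>\<close>, \<open>n' = - \<kappa> t + \<tau> b\<close> and
  \<open>b' = - \<tau> n\<close>, with \<open>\<epsilon> = 1\<close> for the sphere and \<open>\<epsilon> = - 1\<close> for hyperbolic space
  (\<open>frenet_equations\<close>). Put \<open>N = \<langle>p, n\<rangle>\<close> and \<open>B = \<langle>p, b\<rangle>\<close>. Then \<open>\<langle>p, t\<rangle> = 0\<close>, hence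
  \<open>\<kappa> N = C\<close> with the constant \<open>C = \<epsilon> c / r\<^sup>2\<close>, and \<open>N' = \<tau> B\<close>, \<open>B' = - \<tau> N\<close>. If \<open>C\<close> were zero,
  then \<open>N\<close>, hence \<open>N' = \<tau> B\<close> and \<open>B\<close>, would vanish, because \<open>\<tau>\<close> has no zero. The vector \<open>p\<close> would then be
  orthogonal to the basis \<open>\<alpha>, t, n, b\<close> and so be zero (\<open>form_nondegenerate_basis\<close>), which is
  impossible. So \<open>1 / \<kappa> = N / C\<close> and \<open>(1 / \<kappa>)' / \<tau> = B / C\<close>, and the derivative of the latter is
  \<open>- \<tau> N / C = - \<tau> / \<kappa>\<close>.

  The distance formula has two halves. The explicit geodesic from \<open>p\<close> to \<open>x\<close> has the claimed length
  (\<open>angle_in_path_lengths\<close>). Conversely, along any path the Cauchy--Schwarz inequality in the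
  tangent space bounds the speed of the angle seen from \<open>p\<close> by the speed of the path divided by \<open>r\<close>
  (\<open>length_lower_bound\<close>, \<open>angle_lower_bound\<close>).
\<close>

section \<open>The ambient bilinear form\<close>

fun form_sign :: "space_form \<Rightarrow> real" where
  "form_sign Sph = 1"
| "form_sign Hyp = - 1"

lemma form_sign_square [simp]: "form_sign M * form_sign M = 1" "(form_sign M)\<^sup>2 = 1"
  by (cases M; simp)+

lemma form_sign_nonzero [simp]: "form_sign M \<noteq> 0"
  by (cases M; simp)

text \<open>
  Lowering an index turns the form into the Euclidean inner product. The bilinearity of the form and
  its nondegeneracy are inherited from there.
\<close>

definition lower_index :: "space_form \<Rightarrow> real ^ 4 \<Rightarrow> real ^ 4" where
  "lower_index M x = (\<chi> i. if i = 1 then form_sign M * x $ 1 else x $ i)"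

lemma form_eq_inner: "form M x y = lower_index M x \<bullet> y"
  by (cases M) (simp_all add: inner_vec_def sum_4 lower_index_def)

lemma bounded_linear_lower_index: "bounded_linear (lower_index M)"
  unfolding linear_conv_bounded_linear[symmetric]
  by (rule linearI) (auto simp: lower_index_def vec_eq_iff algebra_simps)

lemma lower_index_eq_0_iff: "lower_index M x = 0 \<longleftrightarrow> x = 0"
  by (auto simp: lower_index_def vec_eq_iff)

interpretation form: bounded_bilinear "form M" for M
  unfolding form_eq_inner[abs_def]
  by (rule bounded_bilinear.comp1[OF bounded_bilinear_inner bounded_linear_lower_index])

lemma form_commute: "form M x y = form M y x"
  by (cases M) simp_all

lemma form_points: "x \<in> points M r \<Longrightarrow> form M x x = form_sign M * r\<^sup>2"
  by (cases M) simp_all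

lemma has_vector_derivative_const_on:
  assumes "open I" "s \<in> I" "\<And>u. u \<in> I \<Longrightarrow> f u = c" "(f has_vector_derivative D) (at s)"
  shows "D = 0"
proof -
  have "(f has_vector_derivative 0) (at s)"
    by (rule has_vector_derivative_transform_within_open[OF
        has_vector_derivative_const[of c] assms(1,2)]) (simp add: assms(3))
  with assms(4) show ?thesis
    by (rule vector_derivative_unique_at)
qed

text \<open>Lagrange's identity: the defect is the squared norm of the cross product of the spatial parts.\<close>

lemma spatial_cauchy_schwarz:
  fixes x y :: "real ^ 4"
  shows "(x $ 2 * y $ 2 + x $ 3 * y $ 3 + x $ 4 * y $ 4)\<^sup>2 \<le>
    ((x $ 2)\<^sup>2 + (x $ 3)\<^sup>2 + (x $ 4)\<^sup>2) * ((y $ 2)\<^sup>2 + (y $ 3)\<^sup>2 + (y $ 4)\<^sup>2)"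
proof -
  have "0 \<le> (x $ 2 * y $ 3 - x $ 3 * y $ 2)\<^sup>2 + (x $ 2 * y $ 4 - x $ 4 * y $ 2)\<^sup>2
      + (x $ 3 * y $ 4 - x $ 4 * y $ 3)\<^sup>2"
    by simp
  also have "\<dots> = ((x $ 2)\<^sup>2 + (x $ 3)\<^sup>2 + (x $ 4)\<^sup>2) * ((y $ 2)\<^sup>2 + (y $ 3)\<^sup>2 + (y $ 4)\<^sup>2)
      - (x $ 2 * y $ 2 + x $ 3 * y $ 3 + x $ 4 * y $ 4)\<^sup>2"
    by algebra
  finally show ?thesis by simp
qed

lemma points_Hyp:
  assumes "x \<in> points Hyp r"
  shows "x $ 1 > 0" and "(x $ 2)\<^sup>2 + (x $ 3)\<^sup>2 + (x $ 4)\<^sup>2 = (x $ 1)\<^sup>2 - r\<^sup>2"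
  using assms by (auto simp: power2_eq_square)

text \<open>
  The induced metric is Riemannian. In the hyperbolic case \<open>x\<^sub>1 v\<^sub>1\<close> equals the
  spatial product of \<open>x\<close> and \<open>v\<close>. As \<open>x\<close> is timelike, \<open>x\<^sub>1\<close> exceeds the length of its spatial part, and
  Cauchy--Schwarz forces the spatial part of \<open>v\<close> to be longer than \<open>\<bar>v\<^sub>1\<bar>\<close>.
\<close>

lemma form_tangent_pos:
  assumes "r > 0" "x \<in> points M r" "v \<in> tangent_space M x" "v \<noteq> 0"
  shows "form M v v > 0"
proof (cases M)
  case Sph
  then show ?thesis
    using assms(4) inner_gt_zero_iff[of v] by (simp add: inner_vec_def sum_4)
next
  case Hyp
  define X where "X = (x $ 2)\<^sup>2 + (x $ 3)\<^sup>2 + (x $ 4)\<^sup>2"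
  define V where "V = (v $ 2)\<^sup>2 + (v $ 3)\<^sup>2 + (v $ 4)\<^sup>2"
  have x1: "(x $ 1)\<^sup>2 = X + r\<^sup>2" "x $ 1 > 0"
    using points_Hyp[of x r] assms(2) Hyp by (simp_all add: X_def)
  have orth: "x $ 1 * v $ 1 = x $ 2 * v $ 2 + x $ 3 * v $ 3 + x $ 4 * v $ 4"
    using assms(3) Hyp by (simp add: tangent_space_def)
  have le: "(x $ 1)\<^sup>2 * (v $ 1)\<^sup>2 \<le> X * V"
    using spatial_cauchy_schwarz[of x v] unfolding orth[symmetric] X_def V_def
    by (simp add: power_mult_distrib)
  have "V > 0"
  proof (rule ccontr)
    assume "\<not> V > 0"
    then have "(v $ 2)\<^sup>2 = 0" "(v $ 3)\<^sup>2 = 0" "(v $ 4)\<^sup>2 = 0"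
      using zero_le_power2[of "v $ 2"] zero_le_power2[of "v $ 3"] zero_le_power2[of "v $ 4"]
      unfolding V_def by linarith+
    then have v: "v $ 2 = 0" "v $ 3 = 0" "v $ 4 = 0"
      by simp_all
    with orth x1(2) have "v $ 1 = 0" by simp
    with v assms(4) show False by (simp add: vec_eq_iff forall_4)
  qed
  then have "X * V < (x $ 1)\<^sup>2 * V"
    using x1 \<open>r > 0\<close> by simp
  with le have "(x $ 1)\<^sup>2 * (v $ 1)\<^sup>2 < (x $ 1)\<^sup>2 * V" by simp
  then have "(v $ 1)\<^sup>2 < V"
    by (simp add: mult_less_cancel_left)
  then show ?thesis
    unfolding Hyp V_def by (simp add: power2_eq_square)
qed

lemma form_tangent_cauchy_schwarz:
  assumes "r > 0" "x \<in> points M r" "v \<in> tangent_space M x" "w \<in> tangent_space M x"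
  shows "(form M v w)\<^sup>2 \<le> form M v v * form M w w"
proof (cases "w = 0")
  case True
  then show ?thesis by (simp add: form.zero_right)
next
  case False
  then have pos: "form M w w > 0"
    using form_tangent_pos assms by blast
  \<comment> \<open>a multiple of the component of \<open>v\<close> orthogonal to \<open>w\<close>, scaled to avoid division\<close>
  define z where "z = form M w w *\<^sub>R v - form M v w *\<^sub>R w"
  have "z \<in> tangent_space M x"
    using assms by (simp add: z_def tangent_space_def form.diff_right form.scaleR_right)
  then have "form M z z \<ge> 0"
    using form_tangent_pos assms by (cases "z = 0") (force simp: form.zero_right)+
  also have "form M z z = form M w w * (form M v v * form M w w - (form M v w)\<^sup>2)"
    using form_commute[of M w v]
    by (simp add: z_def form.diff_right form.diff_left form.scaleR_right form.scaleR_left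
        power2_eq_square algebra_simps)
  finally show ?thesis
    using pos by (simp add: zero_le_mult_iff)
qed

section \<open>The normalised product with the centre\<close>

text \<open>
  The factor \<open>form_sign\<close> makes this 1 at \<open>x = p\<close> in both geometries. It is the cosine, respectively the
  hyperbolic cosine, of \<open>1 / r\<close> times the distance from \<open>p\<close> to \<open>x\<close>.
\<close>

definition cosine :: "space_form \<Rightarrow> real \<Rightarrow> real ^ 4 \<Rightarrow> real ^ 4 \<Rightarrow> real" where
  "cosine M r p x = form_sign M * form M p x / r\<^sup>2"

lemma form_eq_cosine: "r > 0 \<Longrightarrow> form M p x = form_sign M * r\<^sup>2 * cosine M r p x"
  by (simp add: cosine_def)

text \<open>
  Subtracting from \<open>p\<close> its component along \<open>x\<close> leaves a tangent vector at \<open>x\<close>. It has the same product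
  as \<open>p\<close> with every tangent vector at \<open>x\<close>, and its length is \<open>r\<close> times the sine (hyperbolic sine) that
  belongs to the cosine.
\<close>

lemma tangential_component:
  assumes "r > 0" "p \<in> points M r" "x \<in> points M r"
  defines "w \<equiv> p - cosine M r p x *\<^sub>R x"
  shows "w \<in> tangent_space M x"
    and "form M w w = form_sign M * r\<^sup>2 * (1 - (cosine M r p x)\<^sup>2)"
proof -
  note form = form_points[OF assms(2)] form_points[OF assms(3)] form_eq_cosine[OF assms(1), of M p x]
  show "w \<in> tangent_space M x"
    using form form_commute[of M p x]
    by (simp add: w_def tangent_space_def form.diff_right form.scaleR_right)
  show "form M w w = form_sign M * r\<^sup>2 * (1 - (cosine M r p x)\<^sup>2)"
    using form form_commute[of M p x]
    by (simp add: w_def form.diff_right form.diff_left form.scaleR_right form.scaleR_left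
        power2_eq_square algebra_simps)
qed

lemma cosine_square_bound:
  assumes "r > 0" "p \<in> points M r" "x \<in> points M r"
  shows "form_sign M * (1 - (cosine M r p x)\<^sup>2) \<ge> 0"
    and "form_sign M * (1 - (cosine M r p x)\<^sup>2) = 0 \<Longrightarrow> p = cosine M r p x *\<^sub>R x"
proof -
  let ?w = "p - cosine M r p x *\<^sub>R x"
  have ww: "form M ?w ?w = r\<^sup>2 * (form_sign M * (1 - (cosine M r p x)\<^sup>2))"
    using tangential_component(2)[OF assms] by (simp add: ac_simps)
  have pos: "?w \<noteq> 0 \<Longrightarrow> form M ?w ?w > 0"
    using form_tangent_pos tangential_component(1) assms by blast
  then have "form M ?w ?w \<ge> 0"
    by (cases "?w = 0") (auto simp: form.zero_right)
  then show "form_sign M * (1 - (cosine M r p x)\<^sup>2) \<ge> 0"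
    using \<open>r > 0\<close> unfolding ww by (simp add: zero_le_mult_iff)
  show "p = cosine M r p x *\<^sub>R x" if "form_sign M * (1 - (cosine M r p x)\<^sup>2) = 0"
    using pos unfolding ww that by auto
qed

fun cosine_range :: "space_form \<Rightarrow> real set" where
  "cosine_range Sph = {- 1..1}"
| "cosine_range Hyp = {1..}"

text \<open>
  In the hyperbolic case, that the tangential component has a nonnegative square only shows that the
  absolute value is at least 1. The sign is positive because both points lie on the upper sheet.
\<close>

lemma cosine_in_range:
  assumes "r > 0" "p \<in> points M r" "x \<in> points M r"
  shows "cosine M r p x \<in> cosine_range M"
proof (cases M)
  case Sph
  then show ?thesis
    using cosine_square_bound(1)[OF assms] by (auto simp: abs_square_le_1)
next
  case Hyp
  have square: "1 \<le> (cosine M r p x)\<^sup>2"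
    using cosine_square_bound(1)[OF assms] Hyp by simp
  have p: "p $ 1 > 0" "(p $ 2)\<^sup>2 + (p $ 3)\<^sup>2 + (p $ 4)\<^sup>2 \<le> (p $ 1)\<^sup>2"
    and x: "x $ 1 > 0" "(x $ 2)\<^sup>2 + (x $ 3)\<^sup>2 + (x $ 4)\<^sup>2 \<le> (x $ 1)\<^sup>2"
    using points_Hyp[of p r] points_Hyp[of x r] assms Hyp by simp_all
  have "(p $ 2 * x $ 2 + p $ 3 * x $ 3 + p $ 4 * x $ 4)\<^sup>2 \<le> (p $ 1)\<^sup>2 * (x $ 1)\<^sup>2"
    by (rule order.trans[OF spatial_cauchy_schwarz mult_mono]) (use p x in auto)
  then have "p $ 2 * x $ 2 + p $ 3 * x $ 3 + p $ 4 * x $ 4 \<le> p $ 1 * x $ 1"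
    using p(1) x(1) by (auto intro: power2_le_imp_le[OF _ mult_nonneg_nonneg] simp: power_mult_distrib)
  then have "cosine M r p x \<ge> 0"
    using Hyp by (simp add: cosine_def divide_nonpos_pos)
  with square show ?thesis
    unfolding Hyp using power2_le_imp_le[of 1 "cosine M r p x"] by (simp add: Hyp)
qed

section \<open>Geodesic distance\<close>

fun angle :: "space_form \<Rightarrow> real \<Rightarrow> real" where
  "angle Sph h = arccos h"
| "angle Hyp h = arcosh h"

text \<open>
  Let \<open>h\<close> be the cosine along the path. Only the tangential component of \<open>p\<close> contributes to \<open>h'\<close>, so
  Cauchy--Schwarz gives \<open>r \<bar>h'\<bar> \<le> \<surd>\<bar>1 - h\<^sup>2\<bar>\<close> times the speed. A function \<open>F\<close> whose derivative is at
  most \<open>1 / \<surd>\<bar>1 - h\<^sup>2\<bar>\<close> thus grows along the path by at most the length divided by \<open>r\<close>. The sharp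
  choices are arccos and arcosh, but these are not differentiable where \<open>\<bar>h\<bar> = 1\<close>, in particular at
  the starting point \<open>p\<close>. Hence the bound is for a differentiable \<open>F\<close>, to be taken close to them.
\<close>

lemma length_lower_bound:
  fixes F F' :: "real \<Rightarrow> real"
  assumes r: "r > 0" and p: "p \<in> points M r"
    and g: "valid_path g" "path_image g \<subseteq> points M r"
    and L: "((\<lambda>u. sqrt (form M (vector_derivative g (at u)) (vector_derivative g (at u))))
       has_integral L) {0..1}"
    and F: "\<And>y. y \<in> cosine_range M \<Longrightarrow> (F has_real_derivative F' y) (at y)"
    and F': "\<And>y. y \<in> cosine_range M \<Longrightarrow> \<bar>F' y\<bar> * sqrt (form_sign M * (1 - y\<^sup>2)) \<le> 1"
  shows "r * (F (cosine M r p (pathfinish g)) - F (cosine M r p (pathstart g))) \<le> L"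
proof -
  define h where "h u = cosine M r p (g u)" for u
  from g(1) obtain S D where cont: "continuous_on {0..1} g" and S: "finite S"
    and D: "\<And>u. u \<in> {0..1} - S \<Longrightarrow> (g has_vector_derivative D u) (at u)"
    unfolding valid_path_def piecewise_C1_differentiable_on_def C1_differentiable_on_def by blast
  have on: "g u \<in> points M r" if "u \<in> {0..1}" for u
    using g(2) that by (auto simp: path_image_def)
  have range: "h u \<in> cosine_range M" if "u \<in> {0..1}" for u
    unfolding h_def by (rule cosine_in_range[OF r p on[OF that]])
  \<comment> \<open>The path is known to lie on the hypersurface for parameters in \<open>[0, 1]\<close> only, so the tangency of
    its velocity is available in the interior only.\<close>
  define E where "E = insert 0 (insert 1 S)"
  define h' where "h' u = form_sign M * form M p (D u) / r\<^sup>2" for u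
  have E: "finite E" using S by (simp add: E_def)
  have tangent: "D u \<in> tangent_space M (g u)" if u: "u \<in> {0..1} - E" for u
  proof -
    have "((\<lambda>u. form M (g u) (g u)) has_vector_derivative form M (g u) (D u) + form M (D u) (g u)) (at u)"
      using u by (intro form.has_vector_derivative D) (auto simp: E_def)
    moreover have "form M (g v) (g v) = form_sign M * r\<^sup>2" if "v \<in> {0<..<1}" for v
      using on[of v] that by (intro form_points) auto
    ultimately have "form M (g u) (D u) + form M (D u) (g u) = 0"
      using u has_vector_derivative_const_on[of "{0<..<1}" u "\<lambda>u. form M (g u) (g u)"]
      by (auto simp: E_def less_le)
    then show ?thesis
      using form_commute[of M "g u" "D u"] by (simp add: tangent_space_def)
  qed
  have bound: "r * (F' (h u) * h' u) \<le> sqrt (form M (D u) (D u))" if u: "u \<in> {0..1} - E" for u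
  proof -
    let ?w = "p - cosine M r p (g u) *\<^sub>R g u"
    have u': "u \<in> {0..1}" using u by auto
    have pD: "form M ?w (D u) = form M p (D u)"
      using tangent[OF u] by (simp add: tangent_space_def form.diff_left form.scaleR_left)
    have "(form M p (D u))\<^sup>2 \<le> form M ?w ?w * form M (D u) (D u)"
      unfolding pD[symmetric]
      by (rule form_tangent_cauchy_schwarz[OF r on[OF u'] tangential_component(1)[OF r p on[OF u']] tangent[OF u]])
    also have "\<dots> = r\<^sup>2 * (form_sign M * (1 - (h u)\<^sup>2) * form M (D u) (D u))"
      unfolding tangential_component(2)[OF r p on[OF u']] by (simp add: h_def)
    finally have "sqrt ((form M p (D u))\<^sup>2) \<le> sqrt (r\<^sup>2 * (form_sign M * (1 - (h u)\<^sup>2) * form M (D u) (D u)))"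
      by (rule real_sqrt_le_mono)
    then have "\<bar>form M p (D u)\<bar> \<le> r * (sqrt (form_sign M * (1 - (h u)\<^sup>2)) * sqrt (form M (D u) (D u)))"
      using r by (simp add: real_sqrt_mult)
    moreover have "r * (r * \<bar>h' u\<bar>) = \<bar>form M p (D u)\<bar>"
      using r by (cases M) (simp_all add: h'_def power2_eq_square del: form.simps)
    ultimately have *: "r * \<bar>h' u\<bar> \<le> sqrt (form_sign M * (1 - (h u)\<^sup>2)) * sqrt (form M (D u) (D u))"
      using r by (metis mult_left_le_imp_le)
    have speed: "sqrt (form M (D u) (D u)) \<ge> 0"
      using form_tangent_pos[OF r on[OF u'] tangent[OF u]]
      by (cases "D u = 0") (auto simp: form.zero_right)
    have "r * (F' (h u) * h' u) \<le> \<bar>r * (F' (h u) * h' u)\<bar>" by simp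
    also have "\<dots> = \<bar>F' (h u)\<bar> * (r * \<bar>h' u\<bar>)"
      using r by (simp add: abs_mult)
    also have "\<dots> \<le> \<bar>F' (h u)\<bar> * (sqrt (form_sign M * (1 - (h u)\<^sup>2)) * sqrt (form M (D u) (D u)))"
      by (rule mult_left_mono[OF *]) simp
    also have "\<dots> = (\<bar>F' (h u)\<bar> * sqrt (form_sign M * (1 - (h u)\<^sup>2))) * sqrt (form M (D u) (D u))"
      by simp
    also have "\<dots> \<le> 1 * sqrt (form M (D u) (D u))"
      by (rule mult_right_mono[OF F'[OF range[OF u']] speed])
    finally show ?thesis by simp
  qed
  have ftc: "((\<lambda>u. r * (F' (h u) * h' u)) has_integral r * F (h 1) - r * F (h 0)) {0..1}"
  proof (rule fundamental_theorem_of_calculus_strong[OF E])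
    have "continuous_on {0..1} h"
      unfolding h_def cosine_def using r
      by (auto intro!: continuous_intros form.continuous_on cont)
    moreover have "continuous_on (cosine_range M) F"
      by (rule continuous_at_imp_continuous_on) (use F DERIV_isCont in blast)
    ultimately have "continuous_on {0..1} (\<lambda>u. F (h u))"
      using range by (intro continuous_on_compose2[of "cosine_range M" F "{0..1}" h]) auto
    then show "continuous_on {0..1} (\<lambda>u. r * F (h u))"
      by (intro continuous_intros)
  next
    fix u assume u: "u \<in> {0..1} - E"
    have "((\<lambda>u. form M p (g u)) has_vector_derivative form M p (D u)) (at u)"
      using form.has_vector_derivative[OF has_vector_derivative_const[of p] D[of u], of M] u
      by (auto simp: E_def form.zero_left)
    then have "(h has_real_derivative h' u) (at u)"
      unfolding h_def cosine_def h'_def has_real_derivative_iff_has_vector_derivative[symmetric]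
      by (rule DERIV_cdivide[OF DERIV_cmult])
    then have "((\<lambda>u. r * F (h u)) has_real_derivative r * (F' (h u) * h' u)) (at u)"
      using u range by (intro DERIV_cmult DERIV_chain2[OF F]) auto
    then show "((\<lambda>u. r * F (h u)) has_vector_derivative r * (F' (h u) * h' u)) (at u)"
      by (simp add: has_real_derivative_iff_has_vector_derivative)
  qed simp
  have "((\<lambda>u. if u \<in> E then r * (F' (h u) * h' u) else sqrt (form M (D u) (D u))) has_integral L) {0..1}"
    by (rule has_integral_spike_finite[OF E _ L])
      (use vector_derivative_at[OF D] in \<open>auto simp: E_def\<close>)
  then have "r * F (h 1) - r * F (h 0) \<le> L"
    by (rule has_integral_le[OF ftc]) (use bound in auto)
  then show ?thesis
    by (simp add: h_def pathfinish_def pathstart_def algebra_simps)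
qed

text \<open>
  Replacing \<open>arccos h\<close> by \<open>arccos (k h)\<close> with \<open>k < 1\<close>, and \<open>arcosh h\<close> by \<open>arcosh (k h)\<close> with \<open>k > 1\<close>,
  moves the argument away from the singular values without making the derivative too
  large: \<open>k\<^sup>2 \<bar>1 - h\<^sup>2\<bar> \<le> \<bar>1 - k\<^sup>2 h\<^sup>2\<bar>\<close>. The bound then passes to the limit \<open>k = 1\<close> by continuity.
\<close>

lemma angle_lower_bound:
  assumes r: "r > 0" and p: "p \<in> points M r" and L: "L \<in> path_lengths M r p x"
  shows "r * angle M (cosine M r p x) \<le> L"
proof -
  from L obtain g where g: "valid_path g" "path_image g \<subseteq> points M r" "pathstart g = p" "pathfinish g = x"
    and len: "((\<lambda>u. sqrt (form M (vector_derivative g (at u)) (vector_derivative g (at u))))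
           has_integral L) {0..1}"
    unfolding path_lengths_def by blast
  define h where "h = cosine M r p x"
  have "x \<in> points M r"
    using g(2,4) by auto
  then have h: "h \<in> cosine_range M"
    unfolding h_def by (rule cosine_in_range[OF r p])
  have pp: "cosine M r p p = 1"
    using form_points[OF p] r by (simp add: cosine_def)
  note bound = length_lower_bound[OF r p g(1,2) len, unfolded g(3,4) pp, folded h_def]
  show ?thesis
  proof (cases M)
    case Sph
    have "r * (arccos (k * h) - arccos (k * 1)) \<le> L" if k: "k \<in> {0..<1}" for k
    proof (rule bound, unfold Sph)
      fix y assume "y \<in> cosine_range Sph"
      then have y: "\<bar>y\<bar> \<le> 1" by auto
      have "\<bar>k * y\<bar> \<le> k * 1"
        using k y unfolding abs_mult by (intro mult_mono) auto
      then have ky: "\<bar>k * y\<bar> < 1"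
        using k by auto
      then show "((\<lambda>y. arccos (k * y)) has_real_derivative - k / sqrt (1 - (k * y)\<^sup>2)) (at y)"
        by (auto intro!: derivative_eq_intros simp: divide_simps)
      have "k\<^sup>2 \<le> 1\<^sup>2"
        using k by (intro power_mono) auto
      then have "k\<^sup>2 * (1 - y\<^sup>2) \<le> 1 - (k * y)\<^sup>2"
        by (simp add: power_mult_distrib algebra_simps)
      then have "k * sqrt (1 - y\<^sup>2) \<le> sqrt (1 - (k * y)\<^sup>2)"
        using k real_sqrt_le_mono by (fastforce simp: real_sqrt_mult)
      moreover have "1 - (k * y)\<^sup>2 > 0"
        using ky by (simp add: abs_square_less_1)
      ultimately show "\<bar>- k / sqrt (1 - (k * y)\<^sup>2)\<bar> * sqrt (form_sign Sph * (1 - y\<^sup>2)) \<le> 1"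
        using k by (simp add: divide_simps abs_of_nonneg)
    qed
    moreover have "continuous_on (closure {0..<1}) (\<lambda>k. r * (arccos (k * h) - arccos (k * 1)))"
    proof -
      have "\<bar>k * h\<bar> \<le> 1" if "k \<in> {0..1}" for k
        using that h Sph unfolding abs_mult by (intro mult_le_one) auto
      then show ?thesis
        by (intro continuous_intros) (auto simp: abs_le_iff)
    qed
    ultimately have "r * (arccos (1 * h) - arccos (1 * 1)) \<le> L"
      by (rule continuous_le_on_closure[where S = "{0..<1}"
          and f = "\<lambda>k. r * (arccos (k * h) - arccos (k * 1))", rotated 2]) simp_all
    then show ?thesis
      using Sph by (simp add: h_def)
  next
    case Hyp
    have "r * (arcosh (k * h) - arcosh (k * 1)) \<le> L" if k: "k \<in> {1<..<2}" for k
    proof (rule bound, unfold Hyp)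
      fix y assume "y \<in> cosine_range Hyp"
      then have y: "1 \<le> y" by auto
      have "k * 1 \<le> k * y"
        using k y by (intro mult_left_mono) auto
      then have ky: "1 < k * y"
        using k unfolding mult_1_right greaterThanLessThan_iff by linarith
      then show "((\<lambda>y. arcosh (k * y)) has_real_derivative k / sqrt ((k * y)\<^sup>2 - 1)) (at y)"
        using DERIV_chain2[OF arcosh_real_has_field_derivative DERIV_cmult_Id, of k y] by simp
      have "1\<^sup>2 \<le> k\<^sup>2"
        using k by (intro power_mono) auto
      then have "k\<^sup>2 * (y\<^sup>2 - 1) \<le> (k * y)\<^sup>2 - 1"
        by (simp add: power_mult_distrib algebra_simps)
      then have "k * sqrt (y\<^sup>2 - 1) \<le> sqrt ((k * y)\<^sup>2 - 1)"
        using k real_sqrt_le_mono by (fastforce simp: real_sqrt_mult)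
      moreover have "(k * y)\<^sup>2 - 1 > 0"
        using ky by (simp add: one_less_power)
      ultimately show "\<bar>k / sqrt ((k * y)\<^sup>2 - 1)\<bar> * sqrt (form_sign Hyp * (1 - y\<^sup>2)) \<le> 1"
        using k by (simp add: divide_simps abs_of_nonneg)
    qed
    moreover have "continuous_on (closure {1<..<2}) (\<lambda>k. r * (arcosh (k * h) - arcosh (k * 1)))"
    proof -
      have "1 * 1 \<le> k * h" if "k \<in> {1..2}" for k
        using that h Hyp by (intro mult_mono) auto
      then show ?thesis
        by (intro continuous_intros) auto
    qed
    ultimately have "r * (arcosh (1 * h) - arcosh (1 * 1)) \<le> L"
      by (rule continuous_le_on_closure[where S = "{1<..<2}"
          and f = "\<lambda>k. r * (arcosh (k * h) - arcosh (k * 1))", rotated 2]) simp_all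
    then show ?thesis
      using Hyp by (simp add: h_def)
  qed
qed


text \<open>
  The circular and the hyperbolic functions, so that the geodesics of both spaces are the curves
  \<open>gcos a p + gsin a e\<close> with \<open>e\<close> orthogonal to \<open>p\<close> of square \<open>r\<^sup>2\<close>.
\<close>

fun gcos :: "space_form \<Rightarrow> real \<Rightarrow> real" where
  "gcos Sph = cos"
| "gcos Hyp = cosh"

fun gsin :: "space_form \<Rightarrow> real \<Rightarrow> real" where
  "gsin Sph = sin"
| "gsin Hyp = sinh"

lemma gcos_gsin_square: "(gcos M a)\<^sup>2 + form_sign M * (gsin M a)\<^sup>2 = 1"
  by (cases M) (simp_all add: cosh_square_eq)

lemma gcos_angle: "h \<in> cosine_range M \<Longrightarrow> gcos M (angle M h) = h"
  by (cases M) auto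

lemma angle_nonneg: "h \<in> cosine_range M \<Longrightarrow> 0 \<le> angle M h"
  by (cases M) (auto simp: arccos_lbound)

lemma has_real_derivative_gcos:
  "(gcos M has_real_derivative - form_sign M * gsin M a) (at a)"
  by (cases M) (auto intro!: derivative_eq_intros)

lemma has_real_derivative_gsin: "(gsin M has_real_derivative gcos M a) (at a)"
  by (cases M) (auto intro!: derivative_eq_intros)

lemma cosine_commute: "cosine M r p x = cosine M r x p"
  by (simp add: cosine_def form_commute)

lemma ex_tangent_of_length:
  assumes r: "r > 0" and p: "p \<in> points M r"
  shows "\<exists>e. form M p e = 0 \<and> form M e e = r\<^sup>2"
proof -
  \<comment> \<open>Swapping coordinates in pairs, with the signs chosen so that the terms of \<open>form M p v\<close> cancel in
    pairs.\<close>
  define v :: "real ^ 4" where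
    "v = (\<chi> i. if i = 1 then - form_sign M * p $ 2 else if i = 2 then p $ 1
      else if i = 3 then - p $ 4 else p $ 3)"
  have pv: "form M p v = 0"
    by (cases M) (simp_all add: v_def)
  have "p \<noteq> 0"
    using form_points[OF p] r by (auto simp: form.zero_left)
  then have "v \<noteq> 0"
    by (auto simp: v_def vec_eq_iff forall_4)
  with pv have pos: "form M v v > 0"
    by (intro form_tangent_pos[OF r p]) (auto simp: tangent_space_def)
  let ?e = "(r / sqrt (form M v v)) *\<^sub>R v"
  have "form M ?e ?e = (r / sqrt (form M v v))\<^sup>2 * form M v v"
    by (simp add: form.scaleR_left form.scaleR_right power2_eq_square)
  also have "\<dots> = r\<^sup>2"
    using pos by (simp add: power_divide)
  finally show ?thesis
    using pv by (intro exI[of _ ?e]) (simp add: form.scaleR_right)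
qed

text \<open>
  The direction is the normalised component of \<open>x\<close> orthogonal to \<open>p\<close>. When \<open>x = p\<close> or \<open>x = - p\<close> this
  component vanishes and every direction leads to \<open>x\<close>.
\<close>

lemma ex_geodesic_direction:
  assumes r: "r > 0" and p: "p \<in> points M r" and x: "x \<in> points M r"
  defines "\<theta> \<equiv> angle M (cosine M r p x)"
  shows "\<exists>e. form M p e = 0 \<and> form M e e = r\<^sup>2 \<and> x = gcos M \<theta> *\<^sub>R p + gsin M \<theta> *\<^sub>R e"
proof -
  define h where "h = cosine M r p x"
  have c: "gcos M \<theta> = h"
    unfolding \<theta>_def h_def by (rule gcos_angle[OF cosine_in_range[OF r p x]])
  have "form_sign M * (1 - h\<^sup>2) = form_sign M * form_sign M * (gsin M \<theta>)\<^sup>2"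
    using gcos_gsin_square[of M \<theta>] unfolding c by (cases M) simp_all
  then have d: "form_sign M * (1 - h\<^sup>2) = (gsin M \<theta>)\<^sup>2"
    by simp
  have h': "cosine M r x p = h"
    unfolding h_def by (rule cosine_commute)
  note w = tangential_component[OF r x p, unfolded h']
  show ?thesis
  proof (cases "gsin M \<theta> = 0")
    case True
    then have "x = h *\<^sub>R p"
      using cosine_square_bound(2)[OF r x p] d h' by simp
    then show ?thesis
      using ex_tangent_of_length[OF r p] c True by simp
  next
    case False
    define e where "e = (1 / gsin M \<theta>) *\<^sub>R (x - h *\<^sub>R p)"
    have "form M p e = 0"
      using w(1) by (simp add: e_def form.scaleR_right tangent_space_def)
    moreover have "form M e e = (1 / gsin M \<theta>)\<^sup>2 * (r\<^sup>2 * (form_sign M * (1 - h\<^sup>2)))"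
      using w(2) by (simp add: e_def form.scaleR_right form.scaleR_left power2_eq_square)
    then have "form M e e = r\<^sup>2"
      unfolding d using False by (simp add: power_divide)
    moreover have "x = gcos M \<theta> *\<^sub>R p + gsin M \<theta> *\<^sub>R e"
      using False c by (simp add: e_def)
    ultimately show ?thesis by blast
  qed
qed

lemma form_orthogonal_combination:
  assumes "p \<in> points M r" "form M p e = 0" "form M e e = r\<^sup>2"
  shows "form M (a *\<^sub>R p + b *\<^sub>R e) (a *\<^sub>R p + b *\<^sub>R e) = r\<^sup>2 * (form_sign M * a\<^sup>2 + b\<^sup>2)"
  using assms(2,3) form_points[OF assms(1)] form_commute[of M e p]
  by (simp add: form.add_left form.add_right form.scaleR_left form.scaleR_right
      power2_eq_square algebra_simps)

lemma geodesic_in_points: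
  assumes r: "r > 0" and p: "p \<in> points M r" and e: "form M p e = 0" "form M e e = r\<^sup>2"
  shows "gcos M a *\<^sub>R p + gsin M a *\<^sub>R e \<in> points M r"
proof -
  let ?y = "gcos M a *\<^sub>R p + gsin M a *\<^sub>R e"
  have yy: "form M ?y ?y = form_sign M * r\<^sup>2"
    unfolding form_orthogonal_combination[OF p e]
    using gcos_gsin_square[of M a] by (cases M) (simp_all add: algebra_simps cosh_square_eq)
  show ?thesis
  proof (cases M)
    case Sph
    then show ?thesis using yy by (simp del: form.simps)
  next
    case Hyp
    note p1 = points_Hyp(1)[OF p[unfolded Hyp]] and pp = points_Hyp(2)[OF p[unfolded Hyp]]
    have pe: "p $ 2 * e $ 2 + p $ 3 * e $ 3 + p $ 4 * e $ 4 = p $ 1 * e $ 1"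
      and ee: "(e $ 2)\<^sup>2 + (e $ 3)\<^sup>2 + (e $ 4)\<^sup>2 = r\<^sup>2 + (e $ 1)\<^sup>2"
      using e Hyp by (auto simp: power2_eq_square)
    have "(p $ 1 * e $ 1)\<^sup>2 \<le> ((p $ 1)\<^sup>2 - r\<^sup>2) * (r\<^sup>2 + (e $ 1)\<^sup>2)"
      using spatial_cauchy_schwarz[of p e] unfolding pp pe ee .
    then have "r\<^sup>2 * (r\<^sup>2 + (e $ 1)\<^sup>2) \<le> r\<^sup>2 * (p $ 1)\<^sup>2"
      by (simp add: power_mult_distrib algebra_simps)
    then have "r\<^sup>2 + \<bar>e $ 1\<bar>\<^sup>2 \<le> (p $ 1)\<^sup>2"
      using r by simp
    moreover have "0 < r\<^sup>2"
      using r by simp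
    ultimately have "\<bar>e $ 1\<bar>\<^sup>2 < (p $ 1)\<^sup>2"
      by linarith
    then have e1: "\<bar>e $ 1\<bar> < p $ 1"
      using p1 by (simp add: power2_less_imp_less)
    \<comment> \<open>Since \<open>\<bar>e\<^sub>1\<bar> < p\<^sub>1\<close> and \<open>\<bar>sinh\<bar> \<le> cosh\<close>, the geodesic never leaves the upper sheet.\<close>
    have "\<bar>sinh a\<bar> \<le> cosh a"
      by (simp add: abs_le_iff sinh_le_cosh_real) (metis cosh_minus sinh_le_cosh_real sinh_minus)
    then have "\<bar>sinh a * e $ 1\<bar> \<le> cosh a * \<bar>e $ 1\<bar>"
      unfolding abs_mult by (rule mult_right_mono) simp
    also have "\<dots> < cosh a * p $ 1"
      using e1 by simp
    finally have "?y $ 1 > 0"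
      unfolding Hyp by simp
    then show ?thesis using yy Hyp by (simp del: form.simps)
  qed
qed

lemma angle_in_path_lengths:
  assumes r: "r > 0" and p: "p \<in> points M r" and x: "x \<in> points M r"
  shows "r * angle M (cosine M r p x) \<in> path_lengths M r p x"
proof -
  define \<theta> where "\<theta> = angle M (cosine M r p x)"
  have \<theta>: "\<theta> \<ge> 0"
    unfolding \<theta>_def by (rule angle_nonneg[OF cosine_in_range[OF r p x]])
  obtain e where e: "form M p e = 0" "form M e e = r\<^sup>2"
    and xe: "x = gcos M \<theta> *\<^sub>R p + gsin M \<theta> *\<^sub>R e"
    using ex_geodesic_direction[OF r p x] unfolding \<theta>_def by blast
  define g where "g u = gcos M (\<theta> * u) *\<^sub>R p + gsin M (\<theta> * u) *\<^sub>R e" for u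
  define D where "D u = (- form_sign M * gsin M (\<theta> * u) * \<theta>) *\<^sub>R p + (gcos M (\<theta> * u) * \<theta>) *\<^sub>R e" for u
  have lin: "((\<lambda>u. \<theta> * u) has_real_derivative \<theta>) (at u)" for u
    by (auto intro!: derivative_eq_intros)
  have g': "(g has_vector_derivative D u) (at u)" for u
    using DERIV_chain2[OF has_real_derivative_gcos lin, of M u]
      DERIV_chain2[OF has_real_derivative_gsin lin, of M u]
    unfolding g_def D_def
    by (auto intro!: derivative_eq_intros simp: has_real_derivative_iff_has_vector_derivative)
  have cont: "continuous_on UNIV (gcos M)" "continuous_on UNIV (gsin M)"
    by (auto intro!: continuous_at_imp_continuous_on DERIV_isCont
        has_real_derivative_gcos has_real_derivative_gsin)
  have "continuous_on {0..1} D"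
    unfolding D_def
    by (intro continuous_intros continuous_on_compose2[OF cont(1)] continuous_on_compose2[OF cont(2)]) auto
  with g' have "valid_path g"
    unfolding valid_path_def
    by (intro C1_differentiable_imp_piecewise) (auto simp: C1_differentiable_on_def)
  moreover have "path_image g \<subseteq> points M r"
    unfolding path_image_def g_def using geodesic_in_points[OF r p e] by blast
  moreover have "pathstart g = p"
    by (cases M) (simp_all add: pathstart_def g_def)
  moreover have "pathfinish g = x"
    by (simp add: pathfinish_def g_def xe)
  moreover have "sqrt (form M (vector_derivative g (at u)) (vector_derivative g (at u))) = r * \<theta>" for u
  proof -
    have "form M (D u) (D u) =
        r\<^sup>2 * \<theta>\<^sup>2 * ((gcos M (\<theta> * u))\<^sup>2 + form_sign M * (gsin M (\<theta> * u))\<^sup>2)"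
      unfolding D_def form_orthogonal_combination[OF p e]
      by (simp add: power_mult_distrib algebra_simps)
    then have "form M (D u) (D u) = (r * \<theta>)\<^sup>2"
      by (simp add: gcos_gsin_square power_mult_distrib)
    then show ?thesis
      using r \<theta> by (simp add: vector_derivative_at[OF g'])
  qed
  then have "((\<lambda>u. sqrt (form M (vector_derivative g (at u)) (vector_derivative g (at u))))
      has_integral r * \<theta>) {0..1}"
    using has_integral_const_real[of "r * \<theta>" 0 1] by simp
  ultimately show ?thesis
    unfolding path_lengths_def \<theta>_def[symmetric] by blast
qed

lemma geodesic_dist_eq:
  assumes "r > 0" "p \<in> points M r" "x \<in> points M r"
  shows "geodesic_dist M r p x = r * angle M (cosine M r p x)"
  unfolding geodesic_dist_def
  using angle_in_path_lengths[OF assms] angle_lower_bound[OF assms(1,2)]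
  by (rule cInf_eq_minimum)

corollary geodesic_sphere_form_const:
  assumes r: "r > 0" and p: "p \<in> points M r"
    and x: "x \<in> geodesic_sphere M r p \<rho>" and y: "y \<in> geodesic_sphere M r p \<rho>"
  shows "form M p x = form M p y"
proof -
  have points: "x \<in> points M r" "y \<in> points M r"
    using x y by (simp_all add: geodesic_sphere_def)
  then have "r * angle M (cosine M r p x) = r * angle M (cosine M r p y)"
    using x y geodesic_dist_eq[OF r p] by (simp add: geodesic_sphere_def)
  then have "gcos M (angle M (cosine M r p x)) = gcos M (angle M (cosine M r p y))"
    using r by simp
  then have "cosine M r p x = cosine M r p y"
    using gcos_angle cosine_in_range[OF r p] points by metis
  then show ?thesis
    by (simp add: form_eq_cosine[OF r])
qed

section \<open>The Frenet equations in the ambient space\<close>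

text \<open>
  The covariant derivative fixes \<open>V'\<close> up to a multiple of the normal \<open>\<alpha> s\<close>. Differentiating
  \<open>\<langle>\<alpha>, V\<rangle> = 0\<close> gives \<open>\<langle>\<alpha>, V'\<rangle> = - \<langle>\<alpha>', V\<rangle>\<close>, which determines the multiple.
\<close>

lemma gauss_formula:
  assumes r: "r > 0" and I: "open I" "s \<in> I"
    and \<alpha>: "\<alpha> s \<in> points M r" "(\<alpha> has_vector_derivative \<alpha>') (at s)"
    and V: "\<And>u. u \<in> I \<Longrightarrow> V u \<in> tangent_space M (\<alpha> u)"
    and D: "has_covariant_derivative M \<alpha> V D s"
  shows "(V has_vector_derivative D - (form_sign M * form M \<alpha>' (V s) / r\<^sup>2) *\<^sub>R \<alpha> s) (at s)"
proof -
  obtain V' where V': "(V has_vector_derivative V') (at s)" and D': "D = tangent_proj M (\<alpha> s) V'"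
    using D unfolding has_covariant_derivative_def by blast
  have "((\<lambda>u. form M (\<alpha> u) (V u)) has_vector_derivative form M (\<alpha> s) V' + form M \<alpha>' (V s)) (at s)"
    by (rule form.has_vector_derivative[OF \<alpha>(2) V'])
  then have "form M (\<alpha> s) V' + form M \<alpha>' (V s) = 0"
    by (rule has_vector_derivative_const_on[OF I, of "\<lambda>u. form M (\<alpha> u) (V u)" 0, rotated])
      (use V in \<open>simp add: tangent_space_def\<close>)
  then have "form M (\<alpha> s) V' / form M (\<alpha> s) (\<alpha> s) = - (form_sign M * form M \<alpha>' (V s) / r\<^sup>2)"
    unfolding form_points[OF \<alpha>(1)] using r by (cases M) (simp_all add: divide_simps del: form.simps)
  then have "V' = D - (form_sign M * form M \<alpha>' (V s) / r\<^sup>2) *\<^sub>R \<alpha> s"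
    by (simp add: D' tangent_proj_def)
  with V' show ?thesis by simp
qed

text \<open>In the Gauss formula only \<open>t\<close> acquires a normal part, since \<open>n\<close> and \<open>b\<close> are orthogonal to \<open>\<alpha>' = t\<close>.\<close>

lemma frenet_equations:
  assumes r: "r > 0" and I: "open I" "s \<in> I"
    and on: "\<alpha> ` I \<subseteq> points M r"
    and frenet: "frenet_frame M \<alpha> I t n b \<kappa> \<tau>"
  shows "(\<alpha> has_vector_derivative t s) (at s)"
    and "(t has_vector_derivative \<kappa> s *\<^sub>R n s - (form_sign M / r\<^sup>2) *\<^sub>R \<alpha> s) (at s)"
    and "(n has_vector_derivative - \<kappa> s *\<^sub>R t s + \<tau> s *\<^sub>R b s) (at s)"
    and "(b has_vector_derivative - \<tau> s *\<^sub>R n s) (at s)"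
proof -
  note frame = frenet[unfolded frenet_frame_def, rule_format]
  show \<alpha>': "(\<alpha> has_vector_derivative t s) (at s)"
    using frame[OF I(2)] by simp
  have "\<alpha> s \<in> points M r"
    using on I(2) by blast
  note gauss = gauss_formula[OF r I this \<alpha>']
  have tangent: "t u \<in> tangent_space M (\<alpha> u)" "n u \<in> tangent_space M (\<alpha> u)"
    "b u \<in> tangent_space M (\<alpha> u)" if "u \<in> I" for u
    using frame[OF that] by simp_all
  have orth: "form M (t s) (t s) = 1" "form M (t s) (n s) = 0" "form M (t s) (b s) = 0"
    using frame[OF I(2)] by simp_all
  have cov: "has_covariant_derivative M \<alpha> t (\<kappa> s *\<^sub>R n s) s"
    "has_covariant_derivative M \<alpha> n (- \<kappa> s *\<^sub>R t s + \<tau> s *\<^sub>R b s) s"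
    "has_covariant_derivative M \<alpha> b (- \<tau> s *\<^sub>R n s) s"
    using frame[OF I(2)] by simp_all
  show "(t has_vector_derivative \<kappa> s *\<^sub>R n s - (form_sign M / r\<^sup>2) *\<^sub>R \<alpha> s) (at s)"
    using gauss[OF tangent(1) cov(1)] orth by simp
  show "(n has_vector_derivative - \<kappa> s *\<^sub>R t s + \<tau> s *\<^sub>R b s) (at s)"
    using gauss[OF tangent(2) cov(2)] orth by simp
  show "(b has_vector_derivative - \<tau> s *\<^sub>R n s) (at s)"
    using gauss[OF tangent(3) cov(3)] orth by simp
qed

lemma vector_4_nth [simp]:
  "(vector [x, y, z, w] :: 'a::zero ^ 4) $ 1 = x"
  "(vector [x, y, z, w] :: 'a::zero ^ 4) $ 2 = y"
  "(vector [x, y, z, w] :: 'a::zero ^ 4) $ 3 = z"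
  "(vector [x, y, z, w] :: 'a::zero ^ 4) $ 4 = w"
  unfolding vector_def by simp_all

lemma form_nondegenerate_basis:
  assumes "det (vector [x, u, v, w] :: real ^ 4 ^ 4) \<noteq> 0"
    and "form M p x = 0" "form M p u = 0" "form M p v = 0" "form M p w = 0"
  shows "p = 0"
proof -
  let ?A = "vector [x, u, v, w] :: real ^ 4 ^ 4"
  have "?A *v lower_index M p = 0"
    using assms(2-) by (simp add: matrix_mult_dot vec_eq_iff forall_4 form_eq_inner inner_commute)
  moreover have "\<exists>B. B ** ?A = mat 1"
    using assms(1) unfolding invertible_det_nz[symmetric] invertible_def by blast
  ultimately have "lower_index M p = 0"
    unfolding matrix_left_invertible_ker by blast
  then show ?thesis
    by (simp add: lower_index_eq_0_iff)
qed

section \<open>Spherical curves\<close>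

theorem theorem6p2p2:
  fixes M :: space_form
    and r \<rho> :: real
    and p :: "real ^ 4"
    and I :: "real set"
    and \<alpha> t n b :: "real \<Rightarrow> real ^ 4"
    and \<kappa> \<tau> :: "real \<Rightarrow> real"
  assumes "r > 0"
    and "open I" and "connected I"
    and "Ck_on 4 \<alpha> I"
    and "\<alpha> ` I \<subseteq> points M r"
    and "frenet_frame M \<alpha> I t n b \<kappa> \<tau>"
    and "\<forall>s\<in>I. \<tau> s \<noteq> 0"
    and "p \<in> points M r"
    and "\<alpha> ` I \<subseteq> geodesic_sphere M r p \<rho>"
  shows "\<forall>s\<in>I.
    (\<lambda>v. 1 / \<kappa> v) differentiable (at s) \<and>
    (\<lambda>u. 1 / \<tau> u * deriv (\<lambda>v. 1 / \<kappa> v) u) differentiable (at s) \<and>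
    deriv (\<lambda>u. 1 / \<tau> u * deriv (\<lambda>v. 1 / \<kappa> v) u) s + \<tau> s / \<kappa> s = 0"
proof
  fix s assume s: "s \<in> I"
  note r = \<open>r > 0\<close> and I = \<open>open I\<close>
  note frenet = frenet_equations[OF r I _ \<open>\<alpha> ` I \<subseteq> points M r\<close>
      \<open>frenet_frame M \<alpha> I t n b \<kappa> \<tau>\<close>]
  have \<kappa>: "\<kappa> u > 0" if "u \<in> I" for u
    using \<open>frenet_frame M \<alpha> I t n b \<kappa> \<tau>\<close> that by (simp add: frenet_frame_def)
  have basis: "det (vector [\<alpha> s, t s, n s, b s] :: real ^ 4 ^ 4) \<noteq> 0"
    using \<open>frenet_frame M \<alpha> I t n b \<kappa> \<tau>\<close> s by (force simp: frenet_frame_def)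
  define c where "c = form M p (\<alpha> s)"
  have c: "form M p (\<alpha> u) = c" if "u \<in> I" for u
    unfolding c_def using \<open>\<alpha> ` I \<subseteq> geodesic_sphere M r p \<rho>\<close> that s
    by (intro geodesic_sphere_form_const[OF r \<open>p \<in> points M r\<close>, where \<rho> = \<rho>]) auto
  have p_deriv: "((\<lambda>u. form M p (V u)) has_real_derivative form M p V') (at u)"
    if "(V has_vector_derivative V') (at u)" for V V' u
    using form.has_vector_derivative[OF has_vector_derivative_const[of p] that, of M]
    by (simp add: form.zero_left has_real_derivative_iff_has_vector_derivative)
  define C where "C = form_sign M * c / r\<^sup>2"
  define N where "N u = form M p (n u)" for u
  define B where "B u = form M p (b u)" for u
  have zero_deriv: "D = 0" if "u \<in> I" "(f has_real_derivative D) (at u)" "\<And>v. v \<in> I \<Longrightarrow> f v = k"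
    for f :: "real \<Rightarrow> real" and D k u
    by (rule has_vector_derivative_const_on[of I u f k D])
      (use that I in \<open>simp_all add: has_real_derivative_iff_has_vector_derivative\<close>)
  have pt: "form M p (t u) = 0" if u: "u \<in> I" for u
    by (rule zero_deriv[OF u p_deriv[OF frenet(1)[OF u]]]) (rule c)
  have \<kappa>N: "\<kappa> u * N u = C" if u: "u \<in> I" for u
  proof -
    have "form M p (\<kappa> u *\<^sub>R n u - (form_sign M / r\<^sup>2) *\<^sub>R \<alpha> u) = 0"
      by (rule zero_deriv[OF u p_deriv[OF frenet(2)[OF u]]]) (rule pt)
    then show ?thesis
      using c[OF u] by (simp add: N_def C_def form.diff_right form.scaleR_right)
  qed
  have N': "(N has_real_derivative \<tau> u * B u) (at u)" if u: "u \<in> I" for u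
    using p_deriv[OF frenet(3)[OF u]] pt[OF u]
    by (simp add: N_def[abs_def] B_def form.add_right form.diff_right form.minus_right form.scaleR_right)
  have B': "(B has_real_derivative - \<tau> u * N u) (at u)" if u: "u \<in> I" for u
    using p_deriv[OF frenet(4)[OF u]]
    by (simp add: N_def B_def[abs_def] form.minus_right form.scaleR_right)
  \<comment> \<open>\<open>C = 0\<close> would mean that the curve lies on a totally geodesic surface and has zero torsion.\<close>
  have C: "C \<noteq> 0"
  proof
    assume "C = 0"
    then have N0: "N u = 0" if "u \<in> I" for u
      using \<kappa>N[OF that] \<kappa>[OF that] by auto
    have "\<tau> s * B s = 0"
      by (rule zero_deriv[OF s N'[OF s]]) (rule N0)
    then have "B s = 0"
      using \<open>\<forall>s\<in>I. \<tau> s \<noteq> 0\<close> s by simp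
    moreover have "form M p (\<alpha> s) = 0"
      using \<open>C = 0\<close> r c[OF s] by (simp add: C_def)
    ultimately have "p = 0"
      using form_nondegenerate_basis[OF basis, of M p] pt[OF s] N0[OF s] by (simp add: N_def B_def)
    then show False
      using form_points[OF \<open>p \<in> points M r\<close>] r by (simp add: form.zero_left)
  qed
  have inv_\<kappa>: "N u / C = 1 / \<kappa> u" if u: "u \<in> I" for u
    using \<kappa>N[OF u] C \<kappa>[OF u] by (auto simp: field_simps)
  have \<kappa>': "((\<lambda>v. 1 / \<kappa> v) has_real_derivative \<tau> u * B u / C) (at u)" if u: "u \<in> I" for u
    by (rule has_field_derivative_transform_within_open[OF DERIV_cdivide[OF N'[OF u]] I u])
      (rule inv_\<kappa>)
  have "B u / C = 1 / \<tau> u * deriv (\<lambda>v. 1 / \<kappa> v) u" if u: "u \<in> I" for u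
    using DERIV_imp_deriv[OF \<kappa>'[OF u]] \<open>\<forall>s\<in>I. \<tau> s \<noteq> 0\<close> u by simp
  then have second: "((\<lambda>u. 1 / \<tau> u * deriv (\<lambda>v. 1 / \<kappa> v) u) has_real_derivative
      - \<tau> s * N s / C) (at s)"
    by (rule has_field_derivative_transform_within_open[OF DERIV_cdivide[OF B'[OF s]] I s])
  have "- \<tau> s * N s / C + \<tau> s / \<kappa> s = 0"
    using arg_cong[OF inv_\<kappa>[OF s], of "\<lambda>y. \<tau> s * y"] by simp
  then show "(\<lambda>v. 1 / \<kappa> v) differentiable (at s) \<and>
    (\<lambda>u. 1 / \<tau> u * deriv (\<lambda>v. 1 / \<kappa> v) u) differentiable (at s) \<and>
    deriv (\<lambda>u. 1 / \<tau> u * deriv (\<lambda>v. 1 / \<kappa> v) u) s + \<tau> s / \<kappa> s = 0"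
    using \<kappa>'[OF s] second by (auto simp: DERIV_imp_deriv real_differentiable_def)
qed

end
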